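(* Assume there are $n$ agents, with agent $n$ as the leader, each with dynamics $\dot x_i=u_i$. Let a directed graph $G$ represent the interconnection between them, which defines the structure of the decentralized control laws given in the context, so that the closed-loop dynamics is $\dot x=Ax+e_nu_n$ with $u_n$ the external input to the leader. Let $\mathcal F=(f_1,\dots,f_n)^T\in\mathbb R^n$ denote the final formation of the agents, and let $\Lambda=[\lambda_1,\dots,\lambda_{n-1},0]$, with $\lambda_i\in\mathbb R\setminus\{0\}$ not necessarily distinct, denote the desired set of closed-loop poles of the system. The following conditions are sufficient to ensure that the agents converge to $\mathcal F$ with the rates specified by $\Lambda$ (for suitable feedback gains): 1. $G$ contains a directed spanning tree with the vertex $n$, corresponding to the leader, as root; 2. $G$ does not have a directed cycle. A controller having the decentralized structure described in the context that achieves this is the solution to the following system of equations: $$\alpha_i=\lambda_i,\qquad f_i\lambda_i+\sum_{j\in\mathcal N_i}\beta_{ij}f_j=0,\qquad\text{for } i=1,\dots,n-1.$$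
   Context: Each agent $i\in\{1,\dots,n\}$ has a scalar state $x_i$ with dynamics $\dot x_i=u_i$. The communication pattern is a directed graph $G$ whose vertices are the agents. For each $i$, $\mathcal N_i$ is the set of (other) agents whose information is available to $i$; an edge of $G$ is directed from $j$ to $i$ when $j\in\mathcal N_i$. A directed spanning tree rooted at a vertex $v$ is a spanning tree in which there is a directed path from $v$ to every other vertex of the graph. Control laws: for $i=1,\dots,n-1$, $$u_i=\sum_{j\in\mathcal N_i}\beta_{ij}x_j+\alpha_i x_i,$$ with real gains $\alpha_i$ (self-feedback) and $\beta_{ij}$ (inter-agent). The leader uses no self-feedback and no information from the other agents ($\alpha_n=0$, $\beta_{nj}=0$), which gives a closed-loop pole at the origin; it is driven only by the external input $u_n$, which is used to drive the leader to $f_n$. The closed loop is $\dot x=Ax+e_nu_n$, where $x=(x_1,\dots,x_n)^T$, $e_n$ is the $n$-th standard basis vector, and $A\in\mathbb R^{n\times n}$ has entries $A_{ii}=\alpha_i$ for $i\le n-1$, $A_{ij}=\beta_{ij}$ for $i\le n-1$ and $j\in\mathcal N_i$, and all other entries zero. That the agents converge to $\mathcal F$ with the rates specified by $\Lambda$ means that, from any given initial condition, with the leader driven to $f_n$ by the external input, the agents asymptotically reach the positions given by $\mathcal F$, the closed-loop poles being $\Lambda$. The constraints imposed on the gains for this purpose are: the roots of $\det(sI-A)$ (with multiplicity) are $\Lambda$, and $A\mathcal F=0$, i.e. $\mathcal F$ is the eigenvector corresponding to the eigenvalue $0$.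
   Formalization: Actual convergence is claimed only when all λ_i<0 (poles Λ and AF=0 are shown for all nonzero λ_i), and existence of gains assumes each follower with f_i≠0 that has neighbours has one with f_j≠0; otherwise the claim fails, e.g. n=2, F=(1,0). *)

theory Defs
  imports
    "HOL-Analysis.Analysis"
    "Jordan_Normal_Form.Char_Poly"
    "Graph_Theory.Graph_Theory"
begin

text \<open>
  Agents are numbered 0, ..., n - 1, and the leader is agent n - 1. The communication pattern is a
  digraph on these agents; an arc (j, i) means that the state of j is available to i.
\<close>

definition nbrs :: "nat pair_pre_digraph \<Rightarrow> nat \<Rightarrow> nat set" where
  "nbrs G i = {j. j \<rightarrow>\<^bsub>G\<^esub> i}"

text \<open>
  The library predicate \<^const>\<open>forest\<close> excludes only directed cycles, so \<^const>\<open>spanning_tree\<close> alone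
  does not make the underlying undirected graph a tree. The second conjunct excludes
  the undirected cycles too: in \<^const>\<open>mk_symmetric\<close> every edge can be traversed back and forth, a cycle
  of length 2, hence the length bound (antiparallel arcs are directed cycles and already excluded).
\<close>
definition directed_spanning_tree ::
    "('a, 'b) pre_digraph \<Rightarrow> ('a, 'b) pre_digraph \<Rightarrow> 'a \<Rightarrow> bool" where
  "directed_spanning_tree T G r \<longleftrightarrow>
     spanning_tree T G \<and>
     (\<nexists>p. pre_digraph.cycle (with_proj (mk_symmetric T)) p \<and> 3 \<le> length p) \<and>
     r \<in> verts T \<and> (\<forall>v \<in> verts T. r \<rightarrow>\<^sup>*\<^bsub>T\<^esub> v)"

definition closed_loop_matrix ::
    "nat \<Rightarrow> nat pair_pre_digraph \<Rightarrow> (nat \<Rightarrow> real) \<Rightarrow> (nat \<Rightarrow> nat \<Rightarrow> real) \<Rightarrow> real mat" where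
  "closed_loop_matrix n G \<alpha> \<beta> = mat n n (\<lambda>(i, j).
     if i = n - 1 then 0
     else if j = i then \<alpha> i
     else if j \<in> nbrs G i then \<beta> i j
     else 0)"

text \<open>The roots of det (s I - A) over the complex numbers, with multiplicity.\<close>
definition poles :: "real mat \<Rightarrow> complex multiset" where
  "poles A = proots (char_poly (map_mat complex_of_real A))"

text \<open>
  Solutions on the time interval from 0 to infinity of x' = A x + e u, where e is the basis
  vector of the leader and u is the external input.
\<close>
definition trajectory ::
    "nat \<Rightarrow> real mat \<Rightarrow> (real \<Rightarrow> real) \<Rightarrow> (real \<Rightarrow> real vec) \<Rightarrow> bool" where
  "trajectory n A u x \<longleftrightarrow>
     (\<forall>t\<ge>0. x t \<in> carrier_vec n) \<and>
     (\<forall>t\<ge>0. \<forall>i<n.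
        ((\<lambda>s. x s $ i) has_real_derivative
          (A *\<^sub>v x t + u t \<cdot>\<^sub>v unit_vec n (n - 1)) $ i) (at t within {0..}))"

text \<open>The initial condition x 0 is arbitrary.\<close>
definition converges_to_formation :: "nat \<Rightarrow> real mat \<Rightarrow> real vec \<Rightarrow> bool" where
  "converges_to_formation n A F \<longleftrightarrow>
     (\<forall>u x. trajectory n A u x \<longrightarrow>
            ((\<lambda>t. x t $ (n - 1)) \<longlongrightarrow> F $ (n - 1)) at_top \<longrightarrow>
            (\<forall>i<n. ((\<lambda>t. x t $ i) \<longlongrightarrow> F $ i) at_top))"

text \<open>
  The desired poles are \<open>\<Lambda> i\<close> for i < n - 1, together with 0. They may be positive, and
  then the closed loop is unstable; convergence of the states is therefore demanded
  only if all of them are negative.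
\<close>
definition achieves_formation ::
    "nat \<Rightarrow> real mat \<Rightarrow> real vec \<Rightarrow> (nat \<Rightarrow> real) \<Rightarrow> bool" where
  "achieves_formation n A F \<Lambda> \<longleftrightarrow>
     poles A = add_mset 0 (image_mset (\<lambda>i. complex_of_real (\<Lambda> i)) (mset_set {..<n - 1})) \<and>
     A *\<^sub>v F = 0\<^sub>v n \<and>
     ((\<forall>i<n - 1. \<Lambda> i < 0) \<longrightarrow> converges_to_formation n A F)"

definition gain_equations ::
    "nat \<Rightarrow> nat pair_pre_digraph \<Rightarrow> real vec \<Rightarrow> (nat \<Rightarrow> real) \<Rightarrow>
     (nat \<Rightarrow> real) \<Rightarrow> (nat \<Rightarrow> nat \<Rightarrow> real) \<Rightarrow> bool" where
  "gain_equations n G F \<Lambda> \<alpha> \<beta> \<longleftrightarrow>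
     (\<forall>i<n - 1. \<alpha> i = \<Lambda> i \<and> F $ i * \<Lambda> i + (\<Sum>j\<in>nbrs G i. \<beta> i j * F $ j) = 0)"

text \<open>
  An agent with a nonzero target whose neighbours all have target 0 admits no solution of its
  gain equation, and no other choice of gains keeps F in the kernel and yields the desired poles either, because 0 is
  then a double pole when G is acyclic.
  This condition excludes such formations; it does not ask an agent to have a neighbour.
\<close>
definition nondegenerate_formation :: "nat \<Rightarrow> nat pair_pre_digraph \<Rightarrow> real vec \<Rightarrow> bool" where
  "nondegenerate_formation n G F \<longleftrightarrow>
     (\<forall>i<n - 1. F $ i \<noteq> 0 \<and> nbrs G i \<noteq> {} \<longrightarrow> (\<exists>j\<in>nbrs G i. F $ j \<noteq> 0))"

end

theory Submission
  imports Defs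
begin

text \<open>
  Since \<open>G\<close> has no directed cycle, its vertices carry a rank that strictly increases along every
  arc (\<open>acyclic_digraph_rank\<close>). Listing the agents by increasing rank makes the closed-loop matrix
  triangular, so its characteristic polynomial is determined by the diagonal (\<open>det_ranked\<close>,
  \<open>char_poly_ranked\<close>) and the poles are the self-feedback gains together with the \<open>0\<close> of the leader.
  The remaining gain equations say row by row that \<open>A F = 0\<close>. They can be solved whenever each
  follower with a nonzero target has a neighbour with a nonzero target; the spanning
  tree guarantees that a follower has a neighbour at all (\<open>follower_has_nbr\<close>).

  For negative poles, convergence is an induction on the rank; the leader converges by
  assumption, and if the neighbours of a follower \<open>i\<close> converge to their
  targets, then \<open>x\<^sub>i\<close> solves a stable scalar equation \<open>y' = \<lambda> y + h\<close> whose forcing term \<open>h\<close> converges,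
  by the gain equation, to \<open>- \<lambda> f\<^sub>i\<close>; hence \<open>x\<^sub>i\<close> converges to \<open>f\<^sub>i\<close> (\<open>stable_scalar_ode_limit\<close>).
\<close>

section \<open>Matrices that are triangular with respect to a rank\<close>

text \<open>
  In the Leibniz formula, a permutation \<open>p\<close> contributes only if \<open>r (p i) \<le> r i\<close> for all \<open>i\<close>. The
  ranks \<open>r (p i)\<close> and \<open>r i\<close> have the same sum, so no inequality can be strict and \<open>p\<close> is the identity.
\<close>
lemma det_ranked:
  fixes A :: "'a :: comm_ring_1 mat" and r :: "nat \<Rightarrow> nat"
  assumes A: "A \<in> carrier_mat n n"
    and r: "\<And>i j. i < n \<Longrightarrow> j < n \<Longrightarrow> j \<noteq> i \<Longrightarrow> A $$ (i, j) \<noteq> 0 \<Longrightarrow> r j < r i"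
  shows "det A = (\<Prod>i<n. A $$ (i, i))"
proof -
  have zero: "(\<Prod>i = 0..<n. A $$ (i, p i)) = 0" if p: "p permutes {0..<n}" and "p \<noteq> id" for p
  proof (rule ccontr)
    assume "(\<Prod>i = 0..<n. A $$ (i, p i)) \<noteq> 0"
    then have nz: "A $$ (i, p i) \<noteq> 0" if "i < n" for i
      using that by (metis atLeast0LessThan finite_lessThan lessThan_iff prod_zero)
    have lt: "p i < n" if "i < n" for i
      using permutes_in_image[OF p, of i] that by simp
    have le: "\<forall>i\<in>{0..<n}. r (p i) \<le> r i"
    proof
      fix i assume "i \<in> {0..<n}"
      then show "r (p i) \<le> r i"
        using r[of i "p i"] nz[of i] lt[of i] by (cases "p i = i") auto
    qed
    obtain k where k: "p k \<noteq> k" using \<open>p \<noteq> id\<close> by (auto simp: fun_eq_iff)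
    then have "k < n" using p by (meson atLeastLessThan_iff le0 permutes_not_in)
    then have "r (p k) < r k" using r nz lt k by blast
    then have "(\<Sum>i\<in>{0..<n}. r (p i)) < (\<Sum>i\<in>{0..<n}. r i)"
      using le \<open>k < n\<close> by (intro sum_strict_mono_ex1) auto
    moreover have "(\<Sum>i\<in>{0..<n}. r (p i)) = (\<Sum>i\<in>{0..<n}. r i)"
      using sum.permute[OF p, of r] by (simp add: comp_def)
    ultimately show False by simp
  qed
  have "det A = (\<Sum>p\<in>{p. p permutes {0..<n}}. signof p * (\<Prod>i = 0..<n. A $$ (i, p i)))"
    by (rule det_def'[OF A])
  also have "\<dots> = (\<Sum>p\<in>{id}. signof p * (\<Prod>i = 0..<n. A $$ (i, p i)))"
    by (rule sum.mono_neutral_right)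
      (auto simp: finite_permutations permutes_id zero)
  also have "\<dots> = (\<Prod>i<n. A $$ (i, i))"
    by (simp add: atLeast0LessThan)
  finally show ?thesis .
qed

lemma char_poly_ranked:
  fixes A :: "'a :: comm_ring_1 mat" and r :: "nat \<Rightarrow> nat"
  assumes A: "A \<in> carrier_mat n n"
    and r: "\<And>i j. i < n \<Longrightarrow> j < n \<Longrightarrow> j \<noteq> i \<Longrightarrow> A $$ (i, j) \<noteq> 0 \<Longrightarrow> r j < r i"
  shows "char_poly A = (\<Prod>i<n. [:- (A $$ (i, i)), 1:])"
proof -
  have "char_poly A = (\<Prod>i<n. char_poly_matrix A $$ (i, i))"
    unfolding char_poly_def
  proof (rule det_ranked)
    show "char_poly_matrix A \<in> carrier_mat n n" using A by simp
    show "r j < r i" if "i < n" "j < n" "j \<noteq> i" "char_poly_matrix A $$ (i, j) \<noteq> 0" for i j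
      using that A by (intro r) (auto simp: char_poly_matrix_def)
  qed
  also have "\<dots> = (\<Prod>i<n. [:- (A $$ (i, i)), 1:])"
    using A by (intro prod.cong) (auto simp: char_poly_matrix_def)
  finally show ?thesis .
qed

lemma proots_prod_linear_factors:
  fixes c :: "'b \<Rightarrow> 'a :: idom"
  assumes "finite S"
  shows "proots (\<Prod>i\<in>S. [:- c i, 1:]) = image_mset c (mset_set S)"
  using assms
proof induction
  case (insert x S)
  have "(\<Prod>i\<in>S. [:- c i, 1:]) \<noteq> 0" using insert.hyps by simp
  then show ?case using insert by (simp add: proots_mult del: mult_pCons_left)
qed simp

section \<open>Acyclic communication graphs\<close>

lemma acyclic_digraph_rank:
  assumes "pair_fin_digraph G" and nocycle: "\<nexists>p. pre_digraph.cycle (with_proj G) p"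
  obtains r :: "'a \<Rightarrow> nat" where "\<And>i j. j \<rightarrow>\<^bsub>G\<^esub> i \<Longrightarrow> r j < r i"
proof -
  interpret pair_fin_digraph G by fact
  have irrefl: "(v, v) \<notin> (parcs G)\<^sup>+" for v
  proof
    assume "(v, v) \<in> (parcs G)\<^sup>+"
    then obtain p where "awalk v p v" "p \<noteq> []"
      using reachable1_awalk[of v v] by auto
    then have "closed_w p" unfolding closed_w_def by blast
    then show False using closed_w_imp_cycle nocycle by blast
  qed
  have fin: "finite ((parcs G)\<^sup>+)"
    using pair_finite_arcs by simp
  have less: "card {k. (k, j) \<in> (parcs G)\<^sup>+} < card {k. (k, i) \<in> (parcs G)\<^sup>+}"
    if "j \<rightarrow>\<^bsub>G\<^esub> i" for i j
  proof (rule psubset_card_mono)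
    have ji: "(j, i) \<in> parcs G" using that by simp
    show "finite {k. (k, i) \<in> (parcs G)\<^sup>+}"
      by (rule finite_subset[OF _ finite_Domain[OF fin]]) blast
    have "{k. (k, j) \<in> (parcs G)\<^sup>+} \<subseteq> {k. (k, i) \<in> (parcs G)\<^sup>+}"
      using ji by (auto intro: trancl_into_trancl)
    moreover have "j \<in> {k. (k, i) \<in> (parcs G)\<^sup>+}" "j \<notin> {k. (k, j) \<in> (parcs G)\<^sup>+}"
      using ji irrefl by auto
    ultimately show "{k. (k, j) \<in> (parcs G)\<^sup>+} \<subset> {k. (k, i) \<in> (parcs G)\<^sup>+}" by blast
  qed
  (* The rank of a vertex is the number of its proper ancestors. *)
  show thesis
    by (rule that[of "\<lambda>v. card {k. (k, v) \<in> (parcs G)\<^sup>+}"]) (rule less)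
qed

lemma follower_has_nbr:
  assumes T: "directed_spanning_tree T (with_proj G) v"
    and i: "i \<in> pverts G" "i \<noteq> v"
  shows "nbrs G i \<noteq> {}"
proof -
  have span: "spanning T (with_proj G)" and reach: "\<forall>w\<in>verts T. v \<rightarrow>\<^sup>*\<^bsub>T\<^esub> w"
    using T by (auto simp: directed_spanning_tree_def spanning_tree_def)
  have sub: "subgraph T (with_proj G)" and "i \<in> verts T"
    using span i by (auto simp: spanning_def)
  then have "v \<rightarrow>\<^sup>*\<^bsub>T\<^esub> i" using reach by blast
  then have "(v, i) \<in> (arcs_ends T)\<^sup>*"
    unfolding reachable_def by (rule rtrancl_on_rtranclI)
  then obtain j where "(j, i) \<in> arcs_ends T" using i by (metis rtranclE)
  then have "(j, i) \<in> arcs_ends (with_proj G)"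
    using arcs_ends_mono[OF sub] by blast
  then show ?thesis by (auto simp: nbrs_def)
qed

section \<open>Stable scalar equations with convergent forcing\<close>

text \<open>
  The solution is the quotient of \<open>exp (- \<mu> t) * y t\<close> by the integrating factor \<open>exp (- \<mu> t)\<close>,
  which tends to infinity. The derivatives have the quotient \<open>h t / (- \<mu>)\<close>, which tends to \<open>c\<close>, so
  l'Hospital's rule applies.
\<close>
lemma stable_scalar_ode_limit:
  fixes y h :: "real \<Rightarrow> real" and \<mu> c :: real
  assumes ode: "\<And>t. t \<ge> 0 \<Longrightarrow> (y has_real_derivative \<mu> * y t + h t) (at t within {0..})"
    and neg: "\<mu> < 0"
    and lim: "(h \<longlongrightarrow> - \<mu> * c) at_top"
  shows "(y \<longlongrightarrow> c) at_top"
proof -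
  have D: "(y has_real_derivative \<mu> * y t + h t) (at t)" if "t > 0" for t
  proof -
    have "at t within {0..} = at t"
      using that by (intro at_within_interior) simp
    then show ?thesis using ode[of t] that by simp
  qed
  have "((\<lambda>t. (exp (- \<mu> * t) * y t) / exp (- \<mu> * t)) \<longlongrightarrow> c) at_top"
  proof (rule lhospital_at_top_at_top)
    show "LIM t at_top. exp (- \<mu> * t) :> at_top"
      using neg by (intro filterlim_compose[OF exp_at_top]
          filterlim_tendsto_pos_mult_at_top[OF tendsto_const]) (auto simp: filterlim_ident)
    show "\<forall>\<^sub>F t in at_top. - \<mu> * exp (- \<mu> * t) \<noteq> 0"
      using neg by simp
    show "\<forall>\<^sub>F t in at_top. ((\<lambda>t. exp (- \<mu> * t) * y t) has_real_derivative
        exp (- \<mu> * t) * h t) (at t)"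
      using eventually_gt_at_top[of 0]
      by eventually_elim (auto intro!: derivative_eq_intros D simp: algebra_simps)
    show "\<forall>\<^sub>F t in at_top. ((\<lambda>t. exp (- \<mu> * t)) has_real_derivative
        - \<mu> * exp (- \<mu> * t)) (at t)"
      by (intro always_eventually) (auto intro!: derivative_eq_intros)
    have "((\<lambda>t. h t / (- \<mu>)) \<longlongrightarrow> (- \<mu> * c) / (- \<mu>)) at_top"
      using neg by (intro tendsto_divide lim) auto
    then show "((\<lambda>t. (exp (- \<mu> * t) * h t) / (- \<mu> * exp (- \<mu> * t))) \<longlongrightarrow> c) at_top"
      using neg by simp
  qed
  then show ?thesis by simp
qed

section \<open>The closed loop\<close>

lemma closed_loop_matrix_carrier: "closed_loop_matrix n G \<alpha> \<beta> \<in> carrier_mat n n"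
  by (simp add: closed_loop_matrix_def)

lemma closed_loop_mult_vec_leader:
  assumes "n > 0" and "v \<in> carrier_vec n"
  shows "(closed_loop_matrix n G \<alpha> \<beta> *\<^sub>v v) $ (n - 1) = 0"
  using assms by (simp add: closed_loop_matrix_def scalar_prod_def)

lemma closed_loop_mult_vec_follower:
  assumes "i < n - 1" and v: "v \<in> carrier_vec n"
    and nb: "nbrs G i \<subseteq> {..<n}" "i \<notin> nbrs G i"
  shows "(closed_loop_matrix n G \<alpha> \<beta> *\<^sub>v v) $ i
       = \<alpha> i * v $ i + (\<Sum>j\<in>nbrs G i. \<beta> i j * v $ j)"
proof -
  have "(closed_loop_matrix n G \<alpha> \<beta> *\<^sub>v v) $ i
      = (\<Sum>j<n. (if j = i then \<alpha> i else if j \<in> nbrs G i then \<beta> i j else 0) * v $ j)"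
    using assms by (auto simp: closed_loop_matrix_def scalar_prod_def atLeast0LessThan
        intro!: sum.cong)
  also have "\<dots> = (\<Sum>j<n. (if j = i then \<alpha> i * v $ i else 0)
                        + (if j \<in> nbrs G i then \<beta> i j * v $ j else 0))"
    using nb(2) by (intro sum.cong) auto
  also have "\<dots> = \<alpha> i * v $ i + (\<Sum>j<n. if j \<in> nbrs G i then \<beta> i j * v $ j else 0)"
    using assms(1) by (simp add: sum.distrib)
  also have "(\<Sum>j<n. if j \<in> nbrs G i then \<beta> i j * v $ j else 0)
      = (\<Sum>j\<in>nbrs G i. \<beta> i j * v $ j)"
    using nb(1) by (simp add: sum.inter_restrict[symmetric] Int_absorb1)
  finally show ?thesis .
qed

lemma closed_loop_poles:
  assumes "n > 0"
    and r: "\<And>i j. j \<in> nbrs G i \<Longrightarrow> r j < (r i :: nat)"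
  shows "poles (closed_loop_matrix n G \<alpha> \<beta>)
       = add_mset 0 (image_mset (\<lambda>i. complex_of_real (\<alpha> i)) (mset_set {..<n - 1}))"
proof -
  let ?A = "map_mat complex_of_real (closed_loop_matrix n G \<alpha> \<beta>)"
  define d where "d i = (if i = n - 1 then 0 else complex_of_real (\<alpha> i))" for i
  have "char_poly ?A = (\<Prod>i<n. [:- (?A $$ (i, i)), 1:])"
    by (rule char_poly_ranked[where r = r])
      (auto simp: closed_loop_matrix_def r split: if_splits)
  also have "\<dots> = (\<Prod>i<n. [:- d i, 1:])"
    by (intro prod.cong) (auto simp: closed_loop_matrix_def d_def)
  finally have "poles (closed_loop_matrix n G \<alpha> \<beta>) = image_mset d (mset_set {..<n})"
    by (simp add: poles_def proots_prod_linear_factors)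
  also have "{..<n} = insert (n - 1) {..<n - 1}" using \<open>n > 0\<close> by auto
  also have "image_mset d (mset_set \<dots>) = add_mset 0 (image_mset d (mset_set {..<n - 1}))"
    by (simp add: d_def)
  also have "image_mset d (mset_set {..<n - 1})
      = image_mset (\<lambda>i. complex_of_real (\<alpha> i)) (mset_set {..<n - 1})"
    by (intro image_mset_cong) (auto simp: d_def)
  finally show ?thesis .
qed

lemma closed_loop_kernel:
  assumes "n > 0" and F: "F \<in> carrier_vec n"
    and nb: "\<And>i. nbrs G i \<subseteq> {..<n}" "\<And>i. i \<notin> nbrs G i"
    and gains: "gain_equations n G F \<Lambda> \<alpha> \<beta>"
  shows "closed_loop_matrix n G \<alpha> \<beta> *\<^sub>v F = 0\<^sub>v n"
proof (rule eq_vecI)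
  fix i assume "i < dim_vec (0\<^sub>v n :: real vec)"
  then have "i < n" by simp
  show "(closed_loop_matrix n G \<alpha> \<beta> *\<^sub>v F) $ i = 0\<^sub>v n $ i"
  proof (cases "i = n - 1")
    case True
    then show ?thesis using closed_loop_mult_vec_leader[OF \<open>n > 0\<close> F] \<open>i < n\<close> by simp
  next
    case False
    then have "i < n - 1" using \<open>i < n\<close> by simp
    then show ?thesis
      using closed_loop_mult_vec_follower[OF _ F nb] gains \<open>i < n\<close>
      by (simp add: gain_equations_def mult.commute)
  qed
qed (simp add: closed_loop_matrix_def)

lemma closed_loop_convergence:
  assumes nb: "\<And>i. nbrs G i \<subseteq> {..<n}" "\<And>i. i \<notin> nbrs G i"
    and r: "\<And>i j. j \<in> nbrs G i \<Longrightarrow> r j < (r i :: nat)"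
    and gains: "gain_equations n G F \<Lambda> \<alpha> \<beta>"
    and neg: "\<forall>i<n - 1. \<Lambda> i < 0"
  shows "converges_to_formation n (closed_loop_matrix n G \<alpha> \<beta>) F"
  unfolding converges_to_formation_def
proof (intro allI impI)
  fix u x i
  assume traj: "trajectory n (closed_loop_matrix n G \<alpha> \<beta>) u x"
    and leader: "((\<lambda>t. x t $ (n - 1)) \<longlongrightarrow> F $ (n - 1)) at_top"
  show "((\<lambda>t. x t $ i) \<longlongrightarrow> F $ i) at_top" if "i < n"
    using that
  proof (induction "r i" arbitrary: i rule: less_induct)
    case less
    show ?case
    proof (cases "i = n - 1")
      case True
      then show ?thesis using leader by simp
    next
      case False
      with less.prems have i: "i < n - 1" by simp
      have gain: "\<alpha> i = \<Lambda> i" "(\<Sum>j\<in>nbrs G i. \<beta> i j * F $ j) = - \<Lambda> i * F $ i"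
        using gains i by (auto simp: gain_equations_def algebra_simps)
      show ?thesis
      proof (rule stable_scalar_ode_limit)
        show "\<Lambda> i < 0" using neg i by blast
        have "((\<lambda>t. \<Sum>j\<in>nbrs G i. \<beta> i j * x t $ j) \<longlongrightarrow> (\<Sum>j\<in>nbrs G i. \<beta> i j * F $ j)) at_top"
          using less.hyps r nb(1) by (intro tendsto_sum tendsto_mult tendsto_const) blast
        then show "((\<lambda>t. \<Sum>j\<in>nbrs G i. \<beta> i j * x t $ j) \<longlongrightarrow> - \<Lambda> i * F $ i) at_top"
          by (simp only: gain)
        show "((\<lambda>t. x t $ i) has_real_derivative
            \<Lambda> i * x t $ i + (\<Sum>j\<in>nbrs G i. \<beta> i j * x t $ j)) (at t within {0..})"
          if "t \<ge> 0" for t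
        proof -
          have "x t \<in> carrier_vec n" using traj that by (simp add: trajectory_def)
          (* The external input acts on the leader only. *)
          then have row: "(closed_loop_matrix n G \<alpha> \<beta> *\<^sub>v x t + u t \<cdot>\<^sub>v unit_vec n (n - 1)) $ i
              = \<Lambda> i * x t $ i + (\<Sum>j\<in>nbrs G i. \<beta> i j * x t $ j)"
            using closed_loop_mult_vec_follower[OF i _ nb] i less.prems gain(1)
            by (simp add: unit_vec_def)
          have "((\<lambda>s. x s $ i) has_real_derivative
              (closed_loop_matrix n G \<alpha> \<beta> *\<^sub>v x t + u t \<cdot>\<^sub>v unit_vec n (n - 1)) $ i)
              (at t within {0..})"
            using traj that less.prems unfolding trajectory_def by blast
          then show ?thesis by (simp only: row)
        qed
      qed
    qed
  qed
qed

lemma gain_equations_solvable: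
  assumes nondeg: "nondegenerate_formation n G F"
    and fin: "\<And>i. finite (nbrs G i)"
    and ne: "\<And>i. i < n - 1 \<Longrightarrow> nbrs G i \<noteq> {}"
  shows "\<exists>\<beta>. gain_equations n G F \<Lambda> \<Lambda> \<beta>"
proof -
  have "\<exists>b. F $ i * \<Lambda> i + (\<Sum>j\<in>nbrs G i. b j * F $ j) = 0" if i: "i < n - 1" for i
  proof (cases "F $ i = 0")
    case True
    then show ?thesis by (intro exI[of _ "\<lambda>_. 0"]) simp
  next
    case False
    then obtain k where k: "k \<in> nbrs G i" "F $ k \<noteq> 0"
      using nondeg ne[OF i] i by (auto simp: nondegenerate_formation_def)
    (* A single neighbour with a nonzero target balances the equation. *)
    define b where "b j = (if j = k then - (F $ i * \<Lambda> i) / F $ k else 0)" for j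
    have "(\<Sum>j\<in>nbrs G i. b j * F $ j)
        = (\<Sum>j\<in>nbrs G i. if j = k then - (F $ i * \<Lambda> i) else 0)"
      using k by (intro sum.cong) (auto simp: b_def)
    also have "\<dots> = - (F $ i * \<Lambda> i)" using k fin by simp
    finally show ?thesis by (intro exI[of _ b]) simp
  qed
  then have "\<forall>i. \<exists>b. i < n - 1 \<longrightarrow> F $ i * \<Lambda> i + (\<Sum>j\<in>nbrs G i. b j * F $ j) = 0"
    by blast
  from choice[OF this] show ?thesis by (auto simp: gain_equations_def)
qed

theorem mainTheorem1:
  fixes n :: nat
    and G :: "nat pair_pre_digraph"
    and F :: "real vec"
    and \<Lambda> :: "nat \<Rightarrow> real"
  assumes "pair_digraph G"
    and "pverts G = {..<n}"
    and "F \<in> carrier_vec n"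
    and "\<forall>i<n - 1. \<Lambda> i \<noteq> 0"
    and "\<exists>T. directed_spanning_tree T (with_proj G) (n - 1)"
    and "\<nexists>p. pre_digraph.cycle (with_proj G) p"
  shows "(nondegenerate_formation n G F \<longrightarrow>
            (\<exists>\<alpha> \<beta>. gain_equations n G F \<Lambda> \<alpha> \<beta> \<and>
                   achieves_formation n (closed_loop_matrix n G \<alpha> \<beta>) F \<Lambda>)) \<and>
         (\<forall>\<alpha> \<beta>. gain_equations n G F \<Lambda> \<alpha> \<beta> \<longrightarrow>
                achieves_formation n (closed_loop_matrix n G \<alpha> \<beta>) F \<Lambda>)"
proof -
  interpret pair_digraph G by fact
  obtain T where T: "directed_spanning_tree T (with_proj G) (n - 1)" using assms(5) by blast
  then have "n - 1 \<in> pverts G"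
    by (auto simp: directed_spanning_tree_def spanning_tree_def spanning_def)
  then have "n > 0" using assms(2) by auto
  obtain r :: "nat \<Rightarrow> nat" where "\<And>i j. j \<rightarrow>\<^bsub>G\<^esub> i \<Longrightarrow> r j < r i"
    using acyclic_digraph_rank[OF pair_fin_digraph_axioms assms(6)] by blast
  then have r: "r j < r i" if "j \<in> nbrs G i" for i j
    using that by (simp add: nbrs_def)
  have nb: "nbrs G i \<subseteq> {..<n}" "i \<notin> nbrs G i" for i
    using in_arcsD1 assms(2) r[of i i] by (auto simp: nbrs_def)
  have sufficient: "achieves_formation n (closed_loop_matrix n G \<alpha> \<beta>) F \<Lambda>"
    if gains: "gain_equations n G F \<Lambda> \<alpha> \<beta>" for \<alpha> \<beta>
    unfolding achieves_formation_def
  proof (intro conjI impI)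
    have "poles (closed_loop_matrix n G \<alpha> \<beta>)
        = add_mset 0 (image_mset (\<lambda>i. complex_of_real (\<alpha> i)) (mset_set {..<n - 1}))"
      using \<open>n > 0\<close> r by (rule closed_loop_poles)
    also have "image_mset (\<lambda>i. complex_of_real (\<alpha> i)) (mset_set {..<n - 1})
        = image_mset (\<lambda>i. complex_of_real (\<Lambda> i)) (mset_set {..<n - 1})"
      using gains by (intro image_mset_cong) (simp add: gain_equations_def)
    finally show "poles (closed_loop_matrix n G \<alpha> \<beta>)
        = add_mset 0 (image_mset (\<lambda>i. complex_of_real (\<Lambda> i)) (mset_set {..<n - 1}))" .
    show "closed_loop_matrix n G \<alpha> \<beta> *\<^sub>v F = 0\<^sub>v n"
      by (rule closed_loop_kernel[OF \<open>n > 0\<close> assms(3) nb gains])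
    show "converges_to_formation n (closed_loop_matrix n G \<alpha> \<beta>) F"
      if "\<forall>i<n - 1. \<Lambda> i < 0"
      by (rule closed_loop_convergence[OF nb r gains that])
  qed
  have "\<exists>\<alpha> \<beta>. gain_equations n G F \<Lambda> \<alpha> \<beta>" if "nondegenerate_formation n G F"
  proof -
    have "nbrs G i \<noteq> {}" if "i < n - 1" for i
      using follower_has_nbr[OF T, of i] that assms(2) by simp
    moreover have "finite (nbrs G i)" for i
      using nb(1) finite_subset by blast
    ultimately show ?thesis using gain_equations_solvable that by blast
  qed
  then show ?thesis using sufficient by blast
qed

end
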